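(* Let $\mathcal{H}$ be a real Hilbert space, and let $K_{1}$ and $K_{2}$ be nonempty closed convex cones in $\mathcal{H}$. Suppose that $c(K_{1},K_{2})<1$, that $K_{1}\cap K_{2}$ and $K_{1}^{\oplus}\cap K_{2}^{\ominus}$ are linear subspaces of $\mathcal{H}$, that $$\overline{K_{1}^{\oplus}+(K_{1}\cap K_{2})}\cap(K_{1}\cap K_{2})^{\perp}=K_{1}^{\oplus},$$ and that $$\overline{K_{2}^{\ominus}+(K_{1}\cap K_{2})}\cap(K_{1}\cap K_{2})^{\perp}=K_{2}^{\ominus}.$$ Then $$c(K_{1},K_{2})\leq c(K_{1}^{\oplus},K_{2}^{\ominus}).$$ If additionally $c(K_{1}^{\oplus},K_{2}^{\ominus})<1$, $$\overline{K_{1}+(K_{1}^{\oplus}\cap K_{2}^{\ominus})}\cap(K_{1}^{\oplus}\cap K_{2}^{\ominus})^{\perp}=K_{1},\quad\text{and}\quad \overline{K_{2}+(K_{1}^{\oplus}\cap K_{2}^{\ominus})}\cap(K_{1}^{\oplus}\cap K_{2}^{\ominus})^{\perp}=K_{2},$$ then $$c(K_{1},K_{2})=c(K_{1}^{\oplus},K_{2}^{\ominus}).$$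
   Context: $\mathcal{H}$ has inner product $\langle\cdot,\cdot\rangle$ and induced norm $\|\cdot\|$; $\mathbf{B}_{\mathcal{H}}$ denotes the closed unit ball. For $S\subseteq\mathcal{H}$, $\operatorname{cone}(S)$ and $\overline{\operatorname{cone}}(S)$ are the smallest convex cone and the smallest closed convex cone containing $S$ (both equal $K$ if $S=K$ is a nonempty closed convex cone; nonempty closed cones contain $0$). For nonempty $C\subseteq\mathcal{H}$, the polar cone is $C^{\ominus}:=\{y\in\mathcal{H}\mid \langle x,y\rangle\leq 0\ \text{for all } x\in C\}$, the dual cone is $C^{\oplus}:=-C^{\ominus}$, and $C^{\perp}$ is the orthogonal complement $\{y\in\mathcal{H}\mid\langle x,y\rangle=0\ \text{for all }x\in C\}$. Sums of sets are Minkowski sums and the overline denotes norm closure. For nonempty convex sets $C,D\subseteq\mathcal{H}$, the cosine of the Dixmier (minimal) angle is $$c_{0}(C,D):=\sup\{\langle x,y\rangle \mid x\in\overline{\operatorname{cone}}(C)\cap\mathbf{B}_{\mathcal{H}},\ y\in\overline{\operatorname{cone}}(D)\cap\mathbf{B}_{\mathcal{H}}\},$$ and the cosine of the Friedrichs angle is $$c(C,D):=c_{0}\big(\operatorname{cone}(C)\cap\overline{C^{\ominus}+D^{\ominus}},\ \operatorname{cone}(D)\cap\overline{C^{\ominus}+D^{\ominus}}\big).$$ *)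

theory Defs
  imports "HOL-Analysis.Analysis"
begin

text \<open>
  A real Hilbert space is a type of class \<^class>\<open>real_inner\<close> and \<^class>\<open>complete_space\<close>;
  Minkowski sums are the \<open>+\<close> of \<open>Set_Algebras\<close>.

  The library predicate \<^const>\<open>convex_cone\<close> asks for a nonempty convex set that is closed under
  scaling by all \<open>c \<ge> 0\<close>, so it contains \<open>0\<close>. For nonempty closed sets this is the same
  as closure under scaling by \<open>c > 0\<close>.
\<close>

abbreviation closed_cone_hull :: "'a::real_normed_vector set \<Rightarrow> 'a set" where
  "closed_cone_hull S \<equiv> (\<lambda>T. closed T \<and> convex_cone T) hull S"

definition polar_cone :: "'a::real_inner set \<Rightarrow> 'a set"  (\<open>(_\<^sup>\<ominus>)\<close> [1000] 999)
  where "C\<^sup>\<ominus> = {y. \<forall>x\<in>C. x \<bullet> y \<le> 0}"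

definition dual_cone :: "'a::real_inner set \<Rightarrow> 'a set"  (\<open>(_\<^sup>\<oplus>)\<close> [1000] 999)
  where "C\<^sup>\<oplus> = uminus ` (C\<^sup>\<ominus>)"

text \<open>
  The sets below are bounded above by \<open>1\<close> and contain \<open>0\<close>, so the suprema are the
  genuine ones.
\<close>

definition cos_dixmier :: "'a::real_inner set \<Rightarrow> 'a set \<Rightarrow> real" where
  "cos_dixmier C D =
     Sup {x \<bullet> y | x y. x \<in> closed_cone_hull C \<inter> cball 0 1 \<and> y \<in> closed_cone_hull D \<inter> cball 0 1}"

definition cos_friedrichs :: "'a::real_inner set \<Rightarrow> 'a set \<Rightarrow> real" where
  "cos_friedrichs C D =
     cos_dixmier ((convex_cone hull C) \<inter> closure (C\<^sup>\<ominus> + D\<^sup>\<ominus>))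
                 ((convex_cone hull D) \<inter> closure (C\<^sup>\<ominus> + D\<^sup>\<ominus>))"

end

theory Submission
  imports Defs
begin

text \<open>
  Write \<open>L = K1 \<inter> K2\<close> and \<open>M = K1\<^sup>\<oplus> \<inter> K2\<^sup>\<ominus>\<close>. By the bipolar theorem \<open>closure (C\<^sup>\<ominus> + D\<^sup>\<ominus>)\<close> is
  \<open>(C \<inter> D)\<^sup>\<ominus>\<close> for closed convex cones, so \<open>c(K1, K2)\<close> is the Dixmier cosine of \<open>A = K1 \<inter> L\<^sup>\<ominus>\<close> and
  \<open>B = K2 \<inter> L\<^sup>\<ominus>\<close>, and \<open>c(K1\<^sup>\<oplus>, K2\<^sup>\<ominus>)\<close> that of \<open>K1\<^sup>\<oplus> \<inter> M\<^sup>\<ominus>\<close> and \<open>K2\<^sup>\<ominus> \<inter> M\<^sup>\<ominus>\<close>; since \<open>L\<close> and \<open>M\<close> are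
  subspaces, \<open>L\<^sup>\<ominus>\<close> and \<open>M\<^sup>\<ominus>\<close> are their orthogonal complements.

  A near-optimal pair for the first cosine produces a near-optimal pair for the second. Let \<open>a \<in> A\<close>
  and \<open>b \<in> B\<close> lie in the unit ball with \<open>a \<bullet> b\<close> close to \<open>c = c(K1, K2)\<close>. Let \<open>p\<close> be the projection
  of \<open>a\<close> on \<open>B\<close> and \<open>q\<close> the projection of \<open>b\<close> on \<open>A\<close>; the residuals \<open>u = q - b\<close> and \<open>v = a - p\<close> lie in
  \<open>A\<^sup>\<oplus>\<close> and \<open>B\<^sup>\<ominus>\<close>. If the supremum \<open>c\<close> were attained at \<open>(a, b)\<close> we would have \<open>p = c b\<close>, \<open>q = c a\<close>, so
  that \<open>u \<bullet> v = c (1 - c\<^sup>2)\<close> while both residuals have squared norm \<open>1 - c\<^sup>2\<close>: when \<open>c < 1\<close> the cosine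
  between them is again \<open>c\<close>. In general, \<open>\<sigma> = a \<bullet> b\<close> satisfies \<open>u \<bullet> v \<ge> \<sigma> - c^3\<close> and the squared norms are
  at most \<open>1 - \<sigma>\<^sup>2\<close> (lemma \<open>projection_residuals\<close>), and letting \<open>\<sigma>\<close> tend to \<open>c\<close> gives the inequality
  (lemma \<open>cosine_bound_of_near_maximizers\<close>).
  The residuals are differences of elements of \<open>A\<close> and \<open>B\<close>, hence orthogonal to both \<open>L\<close> and \<open>M\<close>,
  which places them in \<open>K1\<^sup>\<oplus> \<inter> M\<^sup>\<ominus>\<close> and \<open>K2\<^sup>\<ominus> \<inter> M\<^sup>\<ominus>\<close>.

  The passage from \<open>(K1, K2)\<close> to \<open>(K1\<^sup>\<oplus>, K2\<^sup>\<ominus>)\<close> is an involution that exchanges \<open>L\<close> and \<open>M\<close>, so the same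
  inequality applied to the dual pair gives equality.
\<close>

section \<open>Polar and dual cones\<close>

lemma mem_polar_cone: "y \<in> C\<^sup>\<ominus> \<longleftrightarrow> (\<forall>x\<in>C. x \<bullet> y \<le> 0)"
  by (simp add: polar_cone_def)

lemma mem_dual_cone_iff_minus: "y \<in> C\<^sup>\<oplus> \<longleftrightarrow> - y \<in> C\<^sup>\<ominus>"
  unfolding dual_cone_def by (metis image_iff minus_minus)

lemma mem_dual_cone: "y \<in> C\<^sup>\<oplus> \<longleftrightarrow> (\<forall>x\<in>C. 0 \<le> x \<bullet> y)"
  by (simp add: mem_dual_cone_iff_minus mem_polar_cone)

lemma closed_polar_cone: "closed (C\<^sup>\<ominus>)"
proof -
  have "C\<^sup>\<ominus> = (\<Inter>x\<in>C. {y. x \<bullet> y \<le> 0})"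
    by (auto simp: mem_polar_cone)
  then show ?thesis
    by (simp add: closed_INT closed_halfspace_le)
qed

lemma convex_cone_polar_cone: "convex_cone (C\<^sup>\<ominus>)"
  by (auto simp: convex_cone_iff mem_polar_cone inner_right_distrib mult_nonneg_nonpos
      intro: add_nonpos_nonpos)

lemma closed_dual_cone: "closed (C\<^sup>\<oplus>)"
  unfolding dual_cone_def by (intro closed_negations closed_polar_cone)

lemma convex_cone_dual_cone: "convex_cone (C\<^sup>\<oplus>)"
  unfolding dual_cone_def by (intro convex_cone_negations convex_cone_polar_cone)

lemma inner_eq_0_if_mem_polar_subspace:
  assumes "subspace L" "x \<in> L" "y \<in> L\<^sup>\<ominus>"
  shows "x \<bullet> y = 0"
proof -
  have "- x \<in> L"
    using assms(1,2) by (rule subspace_neg)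
  then have "(- x) \<bullet> y \<le> 0" "x \<bullet> y \<le> 0"
    using assms by (auto simp: mem_polar_cone simp del: inner_minus_left)
  then show ?thesis
    by simp
qed

lemma convex_cone_Int:
  "convex_cone S \<Longrightarrow> convex_cone T \<Longrightarrow> convex_cone (S \<inter> T)"
  by (simp add: convex_cone_iff)


section \<open>Projections and the bipolar theorem in Hilbert space\<close>

text \<open>
  The parallelogram law makes every minimizing sequence Cauchy, so completeness takes the place of
  the local compactness behind the finite-dimensional \<^const>\<open>closest_point\<close>.
\<close>

lemma closed_convex_has_closest_point:
  fixes S :: "'a::{real_inner, complete_space} set"
  assumes "closed S" "convex S" "S \<noteq> {}"
  obtains p where "p \<in> S" "\<forall>y\<in>S. dist x p \<le> dist x y"
proof -
  define D where "D = (\<lambda>y. (norm (x - y))\<^sup>2) ` S"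
  define s where "s = Inf D"
  have bdd: "bdd_below D"
    unfolding D_def by (rule bdd_belowI2[of _ 0]) simp
  have s_le: "s \<le> (norm (x - y))\<^sup>2" if "y \<in> S" for y
    unfolding s_def by (rule cInf_lower) (use that bdd in \<open>auto simp: D_def\<close>)
  have "\<exists>y\<in>S. (norm (x - y))\<^sup>2 < s + inverse (real (Suc n))" for n
  proof -
    have "\<exists>d\<in>D. d < s + inverse (real (Suc n))"
    proof (rule cInf_lessD)
      show "D \<noteq> {}" using assms(3) by (simp add: D_def)
      show "Inf D < s + inverse (real (Suc n))" by (simp add: s_def)
    qed
    then show ?thesis by (auto simp: D_def)
  qed
  then obtain f where fS: "\<And>n. f n \<in> S"
    and f: "\<And>n. (norm (x - f n))\<^sup>2 < s + inverse (real (Suc n))"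
    by metis
  have par: "(norm (f m - f n))\<^sup>2 \<le> 2 * inverse (real (Suc m)) + 2 * inverse (real (Suc n))" for m n
  proof -
    let ?z = "(1/2) *\<^sub>R f m + (1/2) *\<^sub>R f n"
    have "?z \<in> S"
      using assms(2) fS by (intro convexD) auto
    then have "s \<le> (norm (x - ?z))\<^sup>2"
      by (rule s_le)
    moreover have "(norm (f m - f n))\<^sup>2
        = 2 * (norm (x - f m))\<^sup>2 + 2 * (norm (x - f n))\<^sup>2 - 4 * (norm (x - ?z))\<^sup>2"
      by (simp add: power2_norm_eq_inner inner_simps inner_commute field_simps)
    ultimately show ?thesis
      using f[of m] f[of n] by linarith
  qed
  have "Cauchy f"
  proof (rule metric_CauchyI)
    fix e :: real assume e: "0 < e"
    obtain N where N: "inverse (real (Suc N)) < e\<^sup>2 / 4"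
      using reals_Archimedean[of "e\<^sup>2 / 4"] e by auto
    show "\<exists>M. \<forall>m\<ge>M. \<forall>n\<ge>M. dist (f m) (f n) < e"
    proof (intro exI allI impI)
      fix m n assume "N \<le> m" "N \<le> n"
      then have "inverse (real (Suc m)) \<le> inverse (real (Suc N))"
        "inverse (real (Suc n)) \<le> inverse (real (Suc N))"
        by (auto intro!: le_imp_inverse_le)
      then have "(norm (f m - f n))\<^sup>2 < e\<^sup>2"
        using par[of m n] N by linarith
      then show "dist (f m) (f n) < e"
        using e by (simp add: dist_norm power_less_imp_less_base)
    qed
  qed
  then obtain p where p: "f \<longlonglongrightarrow> p"
    using Cauchy_convergent_iff convergent_def by blast
  have "p \<in> S"
    using assms(1) fS p closed_sequentially by blast
  have "(norm (x - p))\<^sup>2 \<le> s"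
  proof (rule LIMSEQ_le)
    show "(\<lambda>n. (norm (x - f n))\<^sup>2) \<longlonglongrightarrow> (norm (x - p))\<^sup>2"
      by (intro tendsto_intros p)
    show "(\<lambda>n. s + inverse (real (Suc n))) \<longlonglongrightarrow> s"
      using tendsto_add[OF tendsto_const[of s] LIMSEQ_inverse_real_of_nat] by simp
    show "\<exists>N. \<forall>n\<ge>N. (norm (x - f n))\<^sup>2 \<le> s + inverse (real (Suc n))"
      using f by (auto intro: less_imp_le)
  qed
  then have "\<forall>y\<in>S. dist x p \<le> dist x y"
    using s_le by (metis dist_norm norm_ge_zero order_trans power2_le_imp_le)
  with \<open>p \<in> S\<close> show ?thesis
    by (rule that)
qed

text \<open>
  For a cone the variational inequality of the closest point can be tested at \<open>0\<close>, at \<open>2 p\<close> and at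
  \<open>p + y\<close>; it then splits into an orthogonality and a polarity statement.
\<close>

lemma moreau_decomposition:
  fixes K :: "'a::{real_inner, complete_space} set"
  assumes "closed K" "convex_cone K"
  obtains p where "p \<in> K" "x - p \<in> K\<^sup>\<ominus>" "p \<bullet> (x - p) = 0"
proof -
  have cK: "convex K" "K \<noteq> {}"
    using assms(2) by (auto simp: convex_cone_def)
  obtain p where p: "p \<in> K" "\<forall>y\<in>K. dist x p \<le> dist x y"
    using closed_convex_has_closest_point[OF assms(1) cK] by blast
  have var: "(x - p) \<bullet> (y - p) \<le> 0" if "y \<in> K" for y
    using any_closest_point_dot[OF cK(1) assms(1) p(1) that p(2)] .
  have "0 \<in> K" "2 *\<^sub>R p \<in> K"
    using assms(2) p(1) by (auto simp: convex_cone_iff)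
  from this[THEN var] have "p \<bullet> (x - p) = 0"
    by (simp add: scaleR_2 inner_commute)
  moreover have "x - p \<in> K\<^sup>\<ominus>"
    unfolding mem_polar_cone
  proof
    fix y assume "y \<in> K"
    then have "p + y \<in> K"
      using assms(2) p(1) by (simp add: convex_cone_iff)
    from var[OF this] show "y \<bullet> (x - p) \<le> 0"
      by (simp add: inner_commute)
  qed
  ultimately show ?thesis
    using p(1) that by blast
qed

lemma polar_polar_cone:
  fixes K :: "'a::{real_inner, complete_space} set"
  assumes "closed K" "convex_cone K"
  shows "(K\<^sup>\<ominus>)\<^sup>\<ominus> = K"
proof
  show "K \<subseteq> (K\<^sup>\<ominus>)\<^sup>\<ominus>"
    by (metis inner_commute mem_polar_cone subsetI)
  show "(K\<^sup>\<ominus>)\<^sup>\<ominus> \<subseteq> K"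
  proof
    fix x assume x: "x \<in> (K\<^sup>\<ominus>)\<^sup>\<ominus>"
    obtain p where p: "p \<in> K" "x - p \<in> K\<^sup>\<ominus>" "p \<bullet> (x - p) = 0"
      using moreau_decomposition[OF assms] by blast
    \<comment> \<open>The residual is polar to \<open>x\<close> and orthogonal to \<open>p\<close>, hence it vanishes.\<close>
    have "(x - p) \<bullet> x \<le> 0"
      using x p(2) by (simp add: mem_polar_cone)
    with p(3) have "(x - p) \<bullet> (x - p) \<le> 0"
      by (simp add: inner_diff_right inner_commute)
    then have "x = p"
      using inner_ge_zero[of "x - p"] by (simp add: inner_eq_zero_iff antisym)
    with p(1) show "x \<in> K"
      by simp
  qed
qed

lemma dual_dual_cone:
  fixes K :: "'a::{real_inner, complete_space} set"
  assumes "closed K" "convex_cone K"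
  shows "(K\<^sup>\<oplus>)\<^sup>\<oplus> = K"
proof -
  have "(K\<^sup>\<oplus>)\<^sup>\<oplus> = (K\<^sup>\<ominus>)\<^sup>\<ominus>"
    unfolding set_eq_iff mem_dual_cone[of _ "K\<^sup>\<oplus>"] mem_polar_cone[of _ "K\<^sup>\<ominus>"]
    by (simp add: dual_cone_def)
  then show ?thesis
    using polar_polar_cone[OF assms] by simp
qed

text \<open>
  Both sides are closed convex cones, so it suffices that their polars agree; the polar of a sum of
  cones is the intersection of the polars.
\<close>

lemma closure_add_polar_cones:
  fixes C D :: "'a::{real_inner, complete_space} set"
  assumes "closed C" "convex_cone C" "closed D" "convex_cone D"
  shows "closure (C\<^sup>\<ominus> + D\<^sup>\<ominus>) = (C \<inter> D)\<^sup>\<ominus>"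
proof -
  let ?S = "C\<^sup>\<ominus> + D\<^sup>\<ominus>"
  have zero: "0 \<in> C\<^sup>\<ominus>" "0 \<in> D\<^sup>\<ominus>"
    by (auto simp: mem_polar_cone)
  have S_eq: "?S = (\<Union>x\<in>C\<^sup>\<ominus>. \<Union>y\<in>D\<^sup>\<ominus>. {x + y})"
    by (auto simp: set_plus_def)
  have "convex_cone ?S"
    unfolding S_eq by (intro convex_cone_sums convex_cone_polar_cone)
  then have "convex ?S" "cone ?S" "?S \<noteq> {}"
    by (auto simp: convex_cone_def conic_def cone_def)
  then have cone: "convex_cone (closure ?S)"
    using cone_closure[of ?S] by (auto simp: convex_cone_def convex_closure conic_def cone_def)
  have "(closure ?S)\<^sup>\<ominus> = C \<inter> D"
  proof
    show "(closure ?S)\<^sup>\<ominus> \<subseteq> C \<inter> D"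
    proof
      fix y assume y: "y \<in> (closure ?S)\<^sup>\<ominus>"
      have "C\<^sup>\<ominus> \<subseteq> ?S" "D\<^sup>\<ominus> \<subseteq> ?S"
        using set_zero_plus2[OF zero(2), of "C\<^sup>\<ominus>"] set_zero_plus2[OF zero(1), of "D\<^sup>\<ominus>"]
        by (simp_all add: add.commute)
      then have "C\<^sup>\<ominus> \<subseteq> closure ?S" "D\<^sup>\<ominus> \<subseteq> closure ?S"
        using closure_subset by blast+
      with y have "y \<in> (C\<^sup>\<ominus>)\<^sup>\<ominus>" "y \<in> (D\<^sup>\<ominus>)\<^sup>\<ominus>"
        unfolding mem_polar_cone by blast+
      then show "y \<in> C \<inter> D"
        using assms by (simp add: polar_polar_cone)
    qed
    show "C \<inter> D \<subseteq> (closure ?S)\<^sup>\<ominus>"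
    proof
      fix y assume y: "y \<in> C \<inter> D"
      have "?S \<subseteq> {x. y \<bullet> x \<le> 0}"
        using y by (auto simp: set_plus_def mem_polar_cone inner_right_distrib
            intro!: add_nonpos_nonpos)
      then have "closure ?S \<subseteq> {x. y \<bullet> x \<le> 0}"
        by (intro closure_minimal closed_halfspace_le)
      then show "y \<in> (closure ?S)\<^sup>\<ominus>"
        by (auto simp: mem_polar_cone inner_commute)
    qed
  qed
  then show ?thesis
    using polar_polar_cone[OF closed_closure cone] by simp
qed


section \<open>Angles between closed convex cones\<close>

lemma cos_dixmier_eq:
  assumes "closed A" "convex_cone A" "closed B" "convex_cone B"
  shows "cos_dixmier A B = Sup {x \<bullet> y | x y. x \<in> A \<inter> cball 0 1 \<and> y \<in> B \<inter> cball 0 1}"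
proof -
  have "closed_cone_hull A = A" "closed_cone_hull B = B"
    using assms by (simp_all add: hull_same)
  then show ?thesis
    unfolding cos_dixmier_def by simp
qed

lemma bdd_above_inner_cball:
  fixes A B :: "'a::real_inner set"
  shows "bdd_above {x \<bullet> y | x y. x \<in> A \<inter> cball 0 1 \<and> y \<in> B \<inter> cball 0 1}"
proof (rule bdd_aboveI)
  fix z assume "z \<in> {x \<bullet> y | x y. x \<in> A \<inter> cball 0 1 \<and> y \<in> B \<inter> cball 0 1}"
  then obtain x y :: 'a where "z = x \<bullet> y" "x \<in> cball 0 1" "y \<in> cball 0 1"
    by blast
  then have z: "z = x \<bullet> y" "norm x \<le> 1" "norm y \<le> 1"
    by simp_all
  have "x \<bullet> y \<le> norm x * norm y"
    by (rule norm_cauchy_schwarz)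
  also have "\<dots> \<le> 1"
    using z by (intro mult_le_one) auto
  finally show "z \<le> 1"
    using z(1) by simp
qed

lemma cos_dixmier_nonneg:
  assumes "closed A" "convex_cone A" "closed B" "convex_cone B"
  shows "0 \<le> cos_dixmier A B"
proof -
  have "0 \<in> A" "0 \<in> B"
    using assms by (auto simp: convex_cone_contains_0)
  then have "0 \<in> {x \<bullet> y | x y. x \<in> A \<inter> cball 0 1 \<and> y \<in> B \<inter> cball 0 1}"
    by (auto intro!: exI[of _ 0])
  then show ?thesis
    unfolding cos_dixmier_eq[OF assms] by (intro cSup_upper bdd_above_inner_cball)
qed

lemma inner_le_cos_dixmier:
  assumes "closed A" "convex_cone A" "closed B" "convex_cone B"
    and "x \<in> A" "y \<in> B"
  shows "x \<bullet> y \<le> cos_dixmier A B * (norm x * norm y)"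
proof (cases "x = 0 \<or> y = 0")
  case False
  let ?x = "inverse (norm x) *\<^sub>R x" and ?y = "inverse (norm y) *\<^sub>R y"
  have "?x \<in> A \<inter> cball 0 1" "?y \<in> B \<inter> cball 0 1"
    using assms False by (auto simp: convex_cone_scaleR)
  then have "?x \<bullet> ?y \<le> cos_dixmier A B"
    unfolding cos_dixmier_eq[OF assms(1-4)]
    by (intro cSup_upper bdd_above_inner_cball) blast
  moreover have "x \<bullet> y = (?x \<bullet> ?y) * (norm x * norm y)"
    using False by (simp add: field_simps)
  ultimately show ?thesis
    by (metis mult_right_mono mult_nonneg_nonneg norm_ge_zero)
qed auto

lemma cos_friedrichs_eq:
  fixes C D :: "'a::{real_inner, complete_space} set"
  assumes "closed C" "convex_cone C" "closed D" "convex_cone D"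
  shows "cos_friedrichs C D = cos_dixmier (C \<inter> (C \<inter> D)\<^sup>\<ominus>) (D \<inter> (C \<inter> D)\<^sup>\<ominus>)"
  using assms by (simp add: cos_friedrichs_def hull_same closure_add_polar_cones)


section \<open>Residuals of projections onto two cones\<close>

text \<open>
  With \<open>p\<close> the projection of \<open>a\<close> on \<open>B\<close> and \<open>q\<close> the projection of \<open>b\<close> on \<open>A\<close>, the residual \<open>a - p\<close> has
  nonpositive product with \<open>b \<in> B\<close> and \<open>q - b\<close> has nonnegative product with \<open>a \<in> A\<close>, so that \<open>p \<bullet> b\<close>
  and \<open>a \<bullet> q\<close> are at least \<open>\<sigma> = a \<bullet> b\<close>. Hence \<open>p\<close> and \<open>q\<close> have norm at least \<open>\<sigma>\<close>, and by Pythagoras the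
  residuals are short. On the other hand \<open>(norm p)\<^sup>2 = a \<bullet> p \<le> c * norm p\<close>, and likewise for \<open>q\<close>, so
  \<open>p \<bullet> q\<close> is at most \<open>c * (c * c)\<close>.
\<close>

lemma projection_residuals:
  fixes A B :: "'a::{real_inner, complete_space} set"
  assumes A: "closed A" "convex_cone A" and B: "closed B" "convex_cone B"
    and bound: "\<And>x y. x \<in> A \<Longrightarrow> y \<in> B \<Longrightarrow> x \<bullet> y \<le> c * (norm x * norm y)"
    and "0 \<le> c"
    and a: "a \<in> A" "norm a \<le> 1" and b: "b \<in> B" "norm b \<le> 1" and "0 \<le> a \<bullet> b"
  obtains p q where "p \<in> B" "q \<in> A" "q - b \<in> A\<^sup>\<oplus>" "a - p \<in> B\<^sup>\<ominus>"
    "(norm (q - b))\<^sup>2 \<le> 1 - (a \<bullet> b)\<^sup>2" "(norm (a - p))\<^sup>2 \<le> 1 - (a \<bullet> b)\<^sup>2"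
    "a \<bullet> b - c ^ 3 \<le> (q - b) \<bullet> (a - p)"
proof -
  define \<sigma> where "\<sigma> = a \<bullet> b"
  obtain p where p: "p \<in> B" "a - p \<in> B\<^sup>\<ominus>" "p \<bullet> (a - p) = 0"
    using moreau_decomposition[OF B] by blast
  obtain q where q: "q \<in> A" "b - q \<in> A\<^sup>\<ominus>" "q \<bullet> (b - q) = 0"
    using moreau_decomposition[OF A] by blast
  have pb: "\<sigma> \<le> p \<bullet> b" and qa: "\<sigma> \<le> q \<bullet> a"
    using p(2) q(2) a(1) b(1)
    by (auto simp: mem_polar_cone \<sigma>_def inner_diff_right inner_commute)
  have pa: "a \<bullet> p = (norm p)\<^sup>2" and qb: "q \<bullet> b = (norm q)\<^sup>2"
    using p(3) q(3) by (simp_all add: power2_norm_eq_inner inner_diff_right inner_commute)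
  have lower: "\<sigma> \<le> norm z" if "\<sigma> \<le> z \<bullet> w" "norm w \<le> 1" for z w :: 'a
    using that norm_cauchy_schwarz[of z w] mult_left_mono[OF that(2), of "norm z"] by simp
  have "norm p \<le> c"
  proof (cases "p = 0")
    case False
    have "norm p * norm p \<le> c * norm a * norm p"
      using bound[OF a(1) p(1)] pa by (simp add: power2_eq_square mult.assoc)
    then have "norm p \<le> c * norm a"
      using False by simp
    also have "\<dots> \<le> c"
      using a(2) \<open>0 \<le> c\<close> by (simp add: mult_left_le)
    finally show ?thesis .
  qed (use \<open>0 \<le> c\<close> in simp)
  moreover have "norm q \<le> c"
  proof (cases "q = 0")
    case False
    have "norm q * norm q \<le> c * norm b * norm q"
      using bound[OF q(1) b(1)] qb by (simp add: power2_eq_square ac_simps)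
    then have "norm q \<le> c * norm b"
      using False by simp
    also have "\<dots> \<le> c"
      using b(2) \<open>0 \<le> c\<close> by (simp add: mult_left_le)
    finally show ?thesis .
  qed (use \<open>0 \<le> c\<close> in simp)
  ultimately have "c * (norm q * norm p) \<le> c * (c * c)"
    using \<open>0 \<le> c\<close> by (intro mult_left_mono mult_mono) auto
  then have qp: "q \<bullet> p \<le> c ^ 3"
    using bound[OF q(1) p(1)] by (simp add: power3_eq_cube)
  have residual: "(norm (z - w))\<^sup>2 \<le> 1 - \<sigma>\<^sup>2"
    if "norm z \<le> 1" "z \<bullet> w = (norm w)\<^sup>2" "\<sigma> \<le> norm w" for z w :: 'a
  proof -
    have "(norm (z - w))\<^sup>2 = (norm z)\<^sup>2 - (norm w)\<^sup>2"
      using that(2) by (simp add: power2_norm_eq_inner inner_simps inner_commute)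
    moreover have "(norm z)\<^sup>2 \<le> 1"
      using that(1) by (simp add: power_le_one)
    moreover have "\<sigma>\<^sup>2 \<le> (norm w)\<^sup>2"
      using that(3) \<open>0 \<le> a \<bullet> b\<close> by (simp add: \<sigma>_def power_mono)
    ultimately show ?thesis
      by linarith
  qed
  show ?thesis
  proof (rule that[OF p(1) q(1)])
    show "q - b \<in> A\<^sup>\<oplus>"
      using q(2) by (simp add: mem_dual_cone mem_polar_cone inner_diff_right)
    show "a - p \<in> B\<^sup>\<ominus>"
      by (rule p(2))
    show "(norm (q - b))\<^sup>2 \<le> 1 - (a \<bullet> b)\<^sup>2"
      using residual[OF b(2), of q] qb lower[OF qa a(2)]
      by (simp add: \<sigma>_def inner_commute norm_minus_commute)
    show "(norm (a - p))\<^sup>2 \<le> 1 - (a \<bullet> b)\<^sup>2"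
      using residual[OF a(2), of p] pa lower[OF pb b(2)] by (simp add: \<sigma>_def)
    have "(q - b) \<bullet> (a - p) = q \<bullet> a - q \<bullet> p - \<sigma> + p \<bullet> b"
      by (simp add: \<sigma>_def inner_simps inner_commute)
    then show "a \<bullet> b - c ^ 3 \<le> (q - b) \<bullet> (a - p)"
      using qa qp pb by (simp add: \<sigma>_def)
  qed
qed

text \<open>
  In the limit \<open>\<sigma> \<rightarrow> c\<close> the hypothesis reads \<open>c (1 - c\<^sup>2) \<le> d (1 - c\<^sup>2)\<close>; here \<open>c < 1\<close> is needed to
  cancel. A value \<open>\<sigma>\<close> above \<open>\<rho>\<close> may be replaced by \<open>\<rho>\<close> itself because \<open>\<sigma>\<close> and \<open>d \<sigma>\<^sup>2\<close> are monotone.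
\<close>

lemma cosine_bound_of_near_maximizers:
  fixes c d :: real
  assumes "0 \<le> c" "c < 1" "0 \<le> d"
    and near: "\<And>\<rho>. 0 \<le> \<rho> \<Longrightarrow> \<rho> < c \<Longrightarrow> \<exists>\<sigma>>\<rho>. \<sigma> - c ^ 3 \<le> d * (1 - \<sigma>\<^sup>2)"
  shows "c \<le> d"
proof (cases "c = 0")
  case False
  then have "0 < c"
    using assms(1) by simp
  have "c - c ^ 3 \<le> d * (1 - c\<^sup>2)"
  proof (rule tendsto_le)
    show "at_left c \<noteq> bot"
      by simp
    show "((\<lambda>\<rho>. \<rho> - c ^ 3) \<longlongrightarrow> c - c ^ 3) (at_left c)"
      "((\<lambda>\<rho>. d * (1 - \<rho>\<^sup>2)) \<longlongrightarrow> d * (1 - c\<^sup>2)) (at_left c)"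
      by (intro tendsto_intros)+
    have "\<rho> - c ^ 3 \<le> d * (1 - \<rho>\<^sup>2)" if \<rho>: "0 < \<rho>" "\<rho> < c" for \<rho>
    proof -
      obtain \<sigma> where \<sigma>: "\<rho> < \<sigma>" "\<sigma> - c ^ 3 \<le> d * (1 - \<sigma>\<^sup>2)"
        using near[OF less_imp_le[OF \<rho>(1)] \<rho>(2)] by blast
      have "d * (1 - \<sigma>\<^sup>2) \<le> d * (1 - \<rho>\<^sup>2)"
        using \<sigma>(1) \<rho>(1) assms(3) by (intro mult_left_mono) (auto simp: power_mono)
      with \<sigma> show ?thesis
        by linarith
    qed
    then show "\<forall>\<^sub>F \<rho> in at_left c. \<rho> - c ^ 3 \<le> d * (1 - \<rho>\<^sup>2)"
      using \<open>0 < c\<close> unfolding eventually_at_left[OF \<open>0 < c\<close>] by blast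
  qed
  then have "c * (1 - c\<^sup>2) \<le> d * (1 - c\<^sup>2)"
    by (simp add: algebra_simps power3_eq_cube power2_eq_square)
  moreover have "0 < 1 - c\<^sup>2"
    using assms(1,2) by (simp add: power_less_one_iff)
  ultimately show ?thesis
    by simp
qed (use assms in simp)


section \<open>Comparison of the angle with that of the dual pair\<close>

text \<open>
  Elements of \<open>K\<close> are sums of an element of \<open>L\<close> and one of \<open>K \<inter> L\<^sup>\<ominus>\<close>, so a vector orthogonal to \<open>L\<close>
  needs to be tested on \<open>K \<inter> L\<^sup>\<ominus>\<close> only.
\<close>

lemma mem_polar_cone_of_mem_polar_section:
  fixes K L :: "'a::{real_inner, complete_space} set"
  assumes "convex_cone K" "subspace L" "closed L" "L \<subseteq> K"
    and "y \<in> (K \<inter> L\<^sup>\<ominus>)\<^sup>\<ominus>" "y \<in> L\<^sup>\<ominus>"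
  shows "y \<in> K\<^sup>\<ominus>"
  unfolding mem_polar_cone
proof
  fix x assume "x \<in> K"
  obtain l where l: "l \<in> L" "x - l \<in> L\<^sup>\<ominus>"
    using moreau_decomposition[OF assms(3) subspace_imp_convex_cone[OF assms(2)]] by blast
  have "- l \<in> K"
    using l(1) assms(2,4) subspace_neg by blast
  then have "x - l \<in> K"
    using convex_cone_add[OF assms(1) \<open>x \<in> K\<close>, of "- l"] by simp
  with l(2) have "(x - l) \<bullet> y \<le> 0"
    using assms(5) unfolding mem_polar_cone[of y "K \<inter> L\<^sup>\<ominus>"] by blast
  moreover have "l \<bullet> y = 0"
    by (rule inner_eq_0_if_mem_polar_subspace[OF assms(2) l(1) assms(6)])
  ultimately show "x \<bullet> y \<le> 0"
    by (simp add: inner_diff_left)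
qed

theorem cos_friedrichs_le_dual_polar:
  fixes K1 K2 :: "'a::{real_inner, complete_space} set"
  assumes K1: "closed K1" "convex_cone K1" and K2: "closed K2" "convex_cone K2"
    and less_1: "cos_friedrichs K1 K2 < 1"
    and L: "subspace (K1 \<inter> K2)"
    and M: "subspace (K1\<^sup>\<oplus> \<inter> K2\<^sup>\<ominus>)"
  shows "cos_friedrichs K1 K2 \<le> cos_friedrichs (K1\<^sup>\<oplus>) (K2\<^sup>\<ominus>)"
proof -
  define L where "L = K1 \<inter> K2"
  define M where "M = K1\<^sup>\<oplus> \<inter> K2\<^sup>\<ominus>"
  define A B where "A = K1 \<inter> L\<^sup>\<ominus>" and "B = K2 \<inter> L\<^sup>\<ominus>"
  define A' B' where "A' = K1\<^sup>\<oplus> \<inter> M\<^sup>\<ominus>" and "B' = K2\<^sup>\<ominus> \<inter> M\<^sup>\<ominus>"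
  define c d where "c = cos_dixmier A B" and "d = cos_dixmier A' B'"
  have c_eq: "cos_friedrichs K1 K2 = c"
    unfolding c_def A_def B_def L_def by (rule cos_friedrichs_eq[OF K1 K2])
  have d_eq: "cos_friedrichs (K1\<^sup>\<oplus>) (K2\<^sup>\<ominus>) = d"
    unfolding d_def A'_def B'_def M_def
    by (intro cos_friedrichs_eq closed_dual_cone closed_polar_cone
        convex_cone_dual_cone convex_cone_polar_cone)
  have A: "closed A" "convex_cone A" and B: "closed B" "convex_cone B"
    using K1 K2 unfolding A_def B_def
    by (auto intro: closed_Int closed_polar_cone convex_cone_Int convex_cone_polar_cone)
  have A': "closed A'" "convex_cone A'" and B': "closed B'" "convex_cone B'"
    unfolding A'_def B'_def
    by (auto intro: closed_Int closed_polar_cone closed_dual_cone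
        convex_cone_Int convex_cone_polar_cone convex_cone_dual_cone)
  have subL: "subspace L" "closed L" "L \<subseteq> K1" "L \<subseteq> K2"
    using assms by (auto simp: L_def)
  have subM: "subspace M"
    using M by (simp add: M_def)
  have c0: "0 \<le> c" and d0: "0 \<le> d"
    unfolding c_def d_def by (rule cos_dixmier_nonneg[OF A B], rule cos_dixmier_nonneg[OF A' B'])
  have diff_L: "x - y \<in> L\<^sup>\<ominus>" if "x \<in> A" "y \<in> B" for x y
    using that inner_eq_0_if_mem_polar_subspace[OF subL(1)]
    by (auto simp: A_def B_def mem_polar_cone[of "x - y"] inner_diff_right)
  \<comment> \<open>An element of \<open>M\<close> has nonnegative product with \<open>x\<close> and nonpositive product with \<open>y\<close>, and so
    has its negative; hence it is orthogonal to both.\<close>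
  have diff_M: "x - y \<in> M\<^sup>\<ominus>" if "x \<in> A" "y \<in> B" for x y
    unfolding mem_polar_cone
  proof
    fix m assume m: "m \<in> M"
    then have "- m \<in> M"
      using subM subspace_neg by blast
    with m that have "0 \<le> x \<bullet> (- m)" "y \<bullet> m \<le> 0" "y \<bullet> (- m) \<le> 0"
      unfolding M_def A_def B_def Int_iff mem_dual_cone[of _ K1] mem_polar_cone[of _ K2] by blast+
    then show "m \<bullet> (x - y) \<le> 0"
      by (simp add: inner_diff_right inner_commute)
  qed
  have "c \<le> d"
  proof (rule cosine_bound_of_near_maximizers[OF c0 _ d0])
    show "c < 1"
      using less_1 c_eq by simp
    fix \<rho> assume "0 \<le> \<rho>" "\<rho> < c"
    have "\<exists>s\<in>{x \<bullet> y | x y. x \<in> A \<inter> cball 0 1 \<and> y \<in> B \<inter> cball 0 1}. \<rho> < s"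
    proof (rule less_cSupD)
      show "{x \<bullet> y | x y. x \<in> A \<inter> cball 0 1 \<and> y \<in> B \<inter> cball 0 1} \<noteq> {}"
        using A(2) B(2) by (auto intro!: exI[of _ 0] simp: convex_cone_contains_0)
      show "\<rho> < Sup {x \<bullet> y | x y. x \<in> A \<inter> cball 0 1 \<and> y \<in> B \<inter> cball 0 1}"
        using \<open>\<rho> < c\<close> by (simp add: c_def cos_dixmier_eq[OF A B])
    qed
    then obtain a b where a: "a \<in> A" "norm a \<le> 1" and b: "b \<in> B" "norm b \<le> 1"
      and ab: "\<rho> < a \<bullet> b"
      by auto
    have bound: "x \<bullet> y \<le> c * (norm x * norm y)" if "x \<in> A" "y \<in> B" for x y
      unfolding c_def by (rule inner_le_cos_dixmier[OF A B that])
    have ab0: "0 \<le> a \<bullet> b"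
      using ab \<open>0 \<le> \<rho>\<close> by simp
    obtain p q where pq: "p \<in> B" "q \<in> A" "q - b \<in> A\<^sup>\<oplus>" "a - p \<in> B\<^sup>\<ominus>"
      and u: "(norm (q - b))\<^sup>2 \<le> 1 - (a \<bullet> b)\<^sup>2" and v: "(norm (a - p))\<^sup>2 \<le> 1 - (a \<bullet> b)\<^sup>2"
      and uv: "a \<bullet> b - c ^ 3 \<le> (q - b) \<bullet> (a - p)"
      using projection_residuals[OF A B bound c0 a b ab0] by blast
    have "a - p \<in> B'"
      using mem_polar_cone_of_mem_polar_section[OF K2(2) subL(1,2,4), of "a - p"]
        pq(4) diff_L[OF a(1) pq(1)] diff_M[OF a(1) pq(1)]
      by (simp add: B_def B'_def)
    moreover have "q - b \<in> A'"
    proof -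
      have "- (q - b) \<in> A\<^sup>\<ominus>"
        using pq(3) by (simp only: mem_dual_cone_iff_minus)
      moreover have "- (q - b) \<in> L\<^sup>\<ominus>"
        using diff_L[OF pq(2) b(1)] inner_eq_0_if_mem_polar_subspace[OF subL(1)]
        by (simp add: mem_polar_cone[of "- _"] del: minus_diff_eq)
      ultimately have "- (q - b) \<in> K1\<^sup>\<ominus>"
        using mem_polar_cone_of_mem_polar_section[OF K1(2) subL(1,2,3)] unfolding A_def by blast
      then have "q - b \<in> K1\<^sup>\<oplus>"
        by (simp only: mem_dual_cone_iff_minus)
      then show ?thesis
        using diff_M[OF pq(2) b(1)] by (simp add: A'_def)
    qed
    ultimately have "(q - b) \<bullet> (a - p) \<le> d * (norm (q - b) * norm (a - p))"
      unfolding d_def by (intro inner_le_cos_dixmier[OF A' B'])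
    also have "\<dots> \<le> d * (1 - (a \<bullet> b)\<^sup>2)"
    proof (rule mult_left_mono[OF _ d0])
      have "2 * (norm (q - b) * norm (a - p)) \<le> (norm (q - b))\<^sup>2 + (norm (a - p))\<^sup>2"
        using sum_squares_bound[of "norm (q - b)" "norm (a - p)"] by (simp add: mult.assoc)
      with u v show "norm (q - b) * norm (a - p) \<le> 1 - (a \<bullet> b)\<^sup>2"
        by linarith
    qed
    finally show "\<exists>\<sigma>>\<rho>. \<sigma> - c ^ 3 \<le> d * (1 - \<sigma>\<^sup>2)"
      using uv ab by (intro exI[of _ "a \<bullet> b"]) linarith
  qed
  then show ?thesis
    by (simp add: c_eq d_eq)
qed

theorem theorem4p2:
  fixes K1 K2 :: "'a::{real_inner, complete_space} set"
  assumes "closed K1" and "convex_cone K1"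
    and "closed K2" and "convex_cone K2"
    and "cos_friedrichs K1 K2 < 1"
    and "subspace (K1 \<inter> K2)"
    and "subspace (K1\<^sup>\<oplus> \<inter> K2\<^sup>\<ominus>)"
    and "closure (K1\<^sup>\<oplus> + (K1 \<inter> K2)) \<inter> (K1 \<inter> K2)\<^sup>\<bottom> = K1\<^sup>\<oplus>"
    and "closure (K2\<^sup>\<ominus> + (K1 \<inter> K2)) \<inter> (K1 \<inter> K2)\<^sup>\<bottom> = K2\<^sup>\<ominus>"
  shows "cos_friedrichs K1 K2 \<le> cos_friedrichs (K1\<^sup>\<oplus>) (K2\<^sup>\<ominus>) \<and>
    (cos_friedrichs (K1\<^sup>\<oplus>) (K2\<^sup>\<ominus>) < 1 \<and>
     closure (K1 + (K1\<^sup>\<oplus> \<inter> K2\<^sup>\<ominus>)) \<inter> (K1\<^sup>\<oplus> \<inter> K2\<^sup>\<ominus>)\<^sup>\<bottom> = K1 \<and>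
     closure (K2 + (K1\<^sup>\<oplus> \<inter> K2\<^sup>\<ominus>)) \<inter> (K1\<^sup>\<oplus> \<inter> K2\<^sup>\<ominus>)\<^sup>\<bottom> = K2
     \<longrightarrow> cos_friedrichs K1 K2 = cos_friedrichs (K1\<^sup>\<oplus>) (K2\<^sup>\<ominus>))"
proof (intro conjI impI)
  show le: "cos_friedrichs K1 K2 \<le> cos_friedrichs (K1\<^sup>\<oplus>) (K2\<^sup>\<ominus>)"
    by (rule cos_friedrichs_le_dual_polar[OF assms(1-7)])
  assume "cos_friedrichs (K1\<^sup>\<oplus>) (K2\<^sup>\<ominus>) < 1 \<and>
     closure (K1 + (K1\<^sup>\<oplus> \<inter> K2\<^sup>\<ominus>)) \<inter> (K1\<^sup>\<oplus> \<inter> K2\<^sup>\<ominus>)\<^sup>\<bottom> = K1 \<and>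
     closure (K2 + (K1\<^sup>\<oplus> \<inter> K2\<^sup>\<ominus>)) \<inter> (K1\<^sup>\<oplus> \<inter> K2\<^sup>\<ominus>)\<^sup>\<bottom> = K2"
  then have less_1: "cos_friedrichs (K1\<^sup>\<oplus>) (K2\<^sup>\<ominus>) < 1"
    by blast
  have bidual: "(K1\<^sup>\<oplus>)\<^sup>\<oplus> = K1" "(K2\<^sup>\<ominus>)\<^sup>\<ominus> = K2"
    using assms(1-4) by (simp_all add: dual_dual_cone polar_polar_cone)
  have "cos_friedrichs (K1\<^sup>\<oplus>) (K2\<^sup>\<ominus>) \<le> cos_friedrichs ((K1\<^sup>\<oplus>)\<^sup>\<oplus>) ((K2\<^sup>\<ominus>)\<^sup>\<ominus>)"
    by (rule cos_friedrichs_le_dual_polar)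
      (use assms(6,7) less_1 in \<open>simp_all add: bidual closed_dual_cone closed_polar_cone
        convex_cone_dual_cone convex_cone_polar_cone\<close>)
  then show "cos_friedrichs K1 K2 = cos_friedrichs (K1\<^sup>\<oplus>) (K2\<^sup>\<ominus>)"
    using le unfolding bidual by (rule antisym[rotated])
qed

end
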